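(* Consider the gradient-descent update of the context at step $k$. Suppose that at step $k$ each weight $w_i[k]$ with oracle value $w_i^{\mathrm{true}}=0$ is distributed as $D_0[k]=\mathcal N(\mu_0[k],\sigma_0^2[k])$ and each weight with oracle value $w_i^{\mathrm{true}}=1$ is distributed as $D_1[k]=\mathcal N(\mu_1[k],\sigma_1^2[k])$. Then after one gradient-descent step, the weights with oracle value $0$ are distributed according to a Gaussian $D_0[k+1]=\mathcal N(\mu_0[k+1],\sigma_0^2[k+1])$ and the weights with oracle value $1$ are distributed according to a Gaussian $D_1[k+1]=\mathcal N(\mu_1[k+1],\sigma_1^2[k+1])$.
   Context: An XOR node with $N\ge2$ real weights is trained against binary oracle weights $w_i^{\mathrm{true}}\in\{0,1\}$, with i.i.d. Bernoulli$(p_e)$ binary inputs. Let $p_w$ be the proportion of oracle weights equal to $1$ and, for each $i$, let $p_w^{(\setminus i)}$ be the proportion of ones among the oracle weights $w_j^{\mathrm{true}}$, $j\ne i$ (it depends on $i$ only through $w_i^{\mathrm{true}}$). Plain gradient descent with learning rate $\alpha$ means $$w_i[k+1]=w_i[k]-\alpha\,g_i[k],$$ where $g_i[k]$ is the expected gradient (averaged over inputs and over the weights $w_j$, $j\neq i$), given by $$g_i[k]=p_e\Big[(2w_i[k]-1)\big((1-p_w^{(\setminus i)})A_0[k]+p_w^{(\setminus i)}A_1[k]\big)^{N-1}-(2w_i^{\mathrm{true}}-1)\big((1-p_w^{(\setminus i)})B_0[k]+p_w^{(\setminus i)}B_1[k]\big)^{N-1}\Big],$$ with $$A_0=4p_e(\mu_0^2+\sigma_0^2)-4p_e\mu_0+1,\quad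 A_1=4p_e(\mu_1^2+\sigma_1^2)-4p_e\mu_1+1,\quad B_0=1-2p_e\mu_0,\quad B_1=1-2p_e(1-\mu_1)$$ (all evaluated at step $k$). A Gaussian with variance $0$ (point mass) counts as Gaussian. *)

theory Defs
  imports "HOL-Probability.Probability"
begin

text \<open>
  The Gaussian law on the real line with mean \<open>\<mu>\<close> and standard deviation \<open>\<sigma> \<ge> 0\<close>. The case
  \<open>\<sigma> = 0\<close> is the point mass at \<open>\<mu>\<close>; it needs separate treatment because the density
  \<open>normal_density \<mu> 0\<close> is identically zero.
\<close>

definition gaussian :: "real \<Rightarrow> real \<Rightarrow> real measure" where
  "gaussian \<mu> \<sigma> =
     (if \<sigma> = 0 then return borel \<mu> else density lborel (\<lambda>x. ennreal (normal_density \<mu> \<sigma> x)))"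

definition gaussian_distributed :: "'a measure \<Rightarrow> ('a \<Rightarrow> real) \<Rightarrow> real \<Rightarrow> real \<Rightarrow> bool" where
  "gaussian_distributed M X \<mu> \<sigma> \<longleftrightarrow>
     X \<in> borel_measurable M \<and> 0 \<le> \<sigma> \<and> distr M borel X = gaussian \<mu> \<sigma>"

text \<open>
  The node has weights indexed by \<open>{..<N}\<close>; \<open>wt i\<close> is the oracle weight of index \<open>i\<close>.
  \<open>ones_excl N wt i\<close> is the proportion of ones among the \<open>N - 1\<close> oracle weights other than the
  \<open>i\<close>-th one.
\<close>

definition ones_excl :: "nat \<Rightarrow> (nat \<Rightarrow> real) \<Rightarrow> nat \<Rightarrow> real" where
  "ones_excl N wt i = real (card {j \<in> {..<N} - {i}. wt j = 1}) / real (N - 1)"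

definition coef_A :: "real \<Rightarrow> real \<Rightarrow> real \<Rightarrow> real" where
  "coef_A pe \<mu> \<sigma> = 4 * pe * (\<mu>\<^sup>2 + \<sigma>\<^sup>2) - 4 * pe * \<mu> + 1"

definition coef_B0 :: "real \<Rightarrow> real \<Rightarrow> real" where
  "coef_B0 pe \<mu>0 = 1 - 2 * pe * \<mu>0"

definition coef_B1 :: "real \<Rightarrow> real \<Rightarrow> real" where
  "coef_B1 pe \<mu>1 = 1 - 2 * pe * (1 - \<mu>1)"

text \<open>
  The gradient with respect to the \<open>i\<close>-th weight at the value \<open>x\<close> of that weight, averaged over
  the Bernoulli(\<open>pe\<close>) inputs and over the other weights, whose laws have mean and standard deviation
  \<open>\<mu>0\<close>, \<open>\<sigma>0\<close> (oracle value 0) and \<open>\<mu>1\<close>, \<open>\<sigma>1\<close> (oracle value 1). It remains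
  a function of \<open>x\<close>, so the gradient of a random weight is itself random.
\<close>

definition expected_gradient ::
    "nat \<Rightarrow> real \<Rightarrow> (nat \<Rightarrow> real) \<Rightarrow> real \<Rightarrow> real \<Rightarrow> real \<Rightarrow> real \<Rightarrow> nat \<Rightarrow> real \<Rightarrow> real" where
  "expected_gradient N pe wt \<mu>0 \<sigma>0 \<mu>1 \<sigma>1 i x =
     (let q = ones_excl N wt i in
      pe * ((2 * x - 1) * ((1 - q) * coef_A pe \<mu>0 \<sigma>0 + q * coef_A pe \<mu>1 \<sigma>1) ^ (N - 1)
          - (2 * wt i - 1) * ((1 - q) * coef_B0 pe \<mu>0 + q * coef_B1 pe \<mu>1) ^ (N - 1)))"

end

theory Submission
  imports Defs
begin

text \<open>
  For a fixed index the update is an affine map of the weight, and affine maps preserve Gaussian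
  laws (a vanishing slope gives a point mass). Its coefficients depend on the index only through
  the oracle value, so the new law is the same within each of the two classes.
\<close>

lemma (in prob_space) gaussian_distributed_affine:
  assumes "gaussian_distributed M X \<mu> \<sigma>"
    and Y: "\<And>x. x \<in> space M \<Longrightarrow> Y x = b + a * X x"
  shows "gaussian_distributed M Y (b + a * \<mu>) (\<bar>a\<bar> * \<sigma>)"
proof -
  from assms have X [measurable]: "X \<in> borel_measurable M" and "0 \<le> \<sigma>"
    and law: "distr M borel X = gaussian \<mu> \<sigma>"
    by (auto simp: gaussian_distributed_def)
  \<comment> \<open>\<open>Y\<close> is tied to \<open>X\<close> only on the space of
    \<open>M\<close>, so measurability and law are transferred by congruence.\<close>
  have Y_meas: "Y \<in> borel_measurable M"
    by (subst measurable_cong[OF Y]) auto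
  have Y_distr: "distr M borel Y = distr M borel (\<lambda>x. b + a * X x)"
    using Y by (intro distr_cong) auto
  have "distr M borel Y = gaussian (b + a * \<mu>) (\<bar>a\<bar> * \<sigma>)"
  proof -
    \<comment> \<open>In the first two cases \<open>\<bar>a\<bar> * \<sigma>\<close> vanishes and
      the target is a point mass; only the third has a density to transform.\<close>
    consider "a = 0" | "\<sigma> = 0" | "a \<noteq> 0" "0 < \<sigma>"
      using \<open>0 \<le> \<sigma>\<close> by fastforce
    then show ?thesis
    proof cases
      case 1
      then show ?thesis
        by (simp add: Y_distr gaussian_def)
    next
      case 2
      \<comment> \<open>Only the law of \<open>X\<close> is known to be a point mass, not
        \<open>X\<close> itself to be constant, so the affine map is applied to the law.\<close>
      have "distr M borel (\<lambda>x. b + a * X x) = distr (distr M borel X) borel (\<lambda>x. b + a * x)"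
        by (subst distr_distr) (auto simp: comp_def)
      then show ?thesis
        using 2 by (simp add: Y_distr law gaussian_def distr_return)
    next
      case 3
      \<comment> \<open>\<open>distributed\<close> with a Lebesgue density takes
        \<open>lborel\<close> as target; \<open>distr\<close> sees only the space and the measurable
        sets of its target, which agree with those of \<open>borel\<close>.\<close>
      have lborel: "distr M lborel Z = distr M borel Z" for Z :: "'a \<Rightarrow> real"
        by (rule distr_cong) simp_all
      have "distributed M lborel X (normal_density \<mu> \<sigma>)"
        using law 3 by (simp add: distributed_def gaussian_def lborel)
      from normal_density_affine[OF this] 3
      have "distributed M lborel (\<lambda>x. b + a * X x) (normal_density (b + a * \<mu>) (\<bar>a\<bar> * \<sigma>))"
        by simp
      then show ?thesis
        using 3 by (simp add: Y_distr distributed_def gaussian_def lborel)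
    qed
  qed
  then show ?thesis
    using Y_meas \<open>0 \<le> \<sigma>\<close> by (simp add: gaussian_distributed_def)
qed

text \<open>Leaving out an index lowers the total count of ones by one exactly when its oracle
  weight is 1, so the count depends on the index only through that weight.\<close>

lemma ones_excl_cong:
  assumes "i < N" "j < N" "wt i = wt j"
  shows "ones_excl N wt i = ones_excl N wt j"
proof -
  have "card {l \<in> {..<N} - {m}. wt l = 1} =
      card {l \<in> {..<N}. wt l = 1} - (if wt m = 1 then 1 else 0)" if "m < N" for m
  proof -
    have "{l \<in> {..<N} - {m}. wt l = 1} = {l \<in> {..<N}. wt l = 1} - {m}"
      by auto
    then show ?thesis
      using that by (simp add: card_Diff_singleton_if)
  qed
  then show ?thesis
    using assms by (simp add: ones_excl_def)
qed

text \<open>The variable \<open>x\<close> enters the gradient only through the factor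
  \<open>2 * x - 1\<close>. The witnesses precede the quantifier over \<open>i\<close>, so one
  affine map serves the whole class.\<close>

lemma expected_gradient_affine:
  assumes "\<And>i. i < N \<Longrightarrow> wt i = c \<Longrightarrow> ones_excl N wt i = q"
  shows "\<exists>a b. \<forall>i<N. wt i = c \<longrightarrow> (\<forall>x.
    x - \<alpha> * expected_gradient N pe wt \<mu>0 \<sigma>0 \<mu>1 \<sigma>1 i x = b + a * x)"
proof -
  define P where "P = ((1 - q) * coef_A pe \<mu>0 \<sigma>0 + q * coef_A pe \<mu>1 \<sigma>1) ^ (N - 1)"
  define Q where "Q = ((1 - q) * coef_B0 pe \<mu>0 + q * coef_B1 pe \<mu>1) ^ (N - 1)"
  have "x - \<alpha> * expected_gradient N pe wt \<mu>0 \<sigma>0 \<mu>1 \<sigma>1 i x =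
      \<alpha> * pe * (P + (2 * c - 1) * Q) + (1 - 2 * \<alpha> * pe * P) * x"
    if "i < N" "wt i = c" for i x
  proof -
    have eq: "expected_gradient N pe wt \<mu>0 \<sigma>0 \<mu>1 \<sigma>1 i x = pe * ((2 * x - 1) * P - (2 * c - 1) * Q)"
      using assms[OF that] that(2) by (simp add: expected_gradient_def P_def Q_def)
    show ?thesis
      unfolding eq by (simp add: algebra_simps)
  qed
  then show ?thesis
    by blast
qed

text \<open>The law of the class \<open>c\<close> is kept apart from the moments inside the
  gradient, so that the same argument serves both oracle values.\<close>

lemma (in prob_space) gradient_step_gaussian:
  assumes X: "\<And>i. i < N \<Longrightarrow> wt i = c \<Longrightarrow> gaussian_distributed M (X i) \<mu> \<sigma>"
    and Y: "\<And>i \<omega>. i < N \<Longrightarrow> \<omega> \<in> space M \<Longrightarrow>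
      Y i \<omega> = X i \<omega> - \<alpha> * expected_gradient N pe wt \<mu>0 \<sigma>0 \<mu>1 \<sigma>1 i (X i \<omega>)"
    and "0 \<le> \<sigma>"
  shows "\<exists>\<mu>' \<sigma>'. 0 \<le> \<sigma>' \<and> (\<forall>i<N. wt i = c \<longrightarrow> gaussian_distributed M (Y i) \<mu>' \<sigma>')"
proof -
  \<comment> \<open>Any member of the class supplies the common proportion; for an empty class every
    value works, and 0 is taken.\<close>
  obtain q where q: "\<And>i. i < N \<Longrightarrow> wt i = c \<Longrightarrow> ones_excl N wt i = q"
  proof (cases "\<exists>j<N. wt j = c")
    case True
    then obtain j where "j < N" "wt j = c"
      by blast
    then have "ones_excl N wt i = ones_excl N wt j" if "i < N" "wt i = c" for i
      using that by (intro ones_excl_cong) auto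
    then show thesis
      by (rule that)
  next
    case False
    then have "ones_excl N wt i = 0" if "i < N" "wt i = c" for i
      using that by blast
    then show thesis
      by (rule that)
  qed
  from expected_gradient_affine[of N wt c q \<alpha> pe \<mu>0 \<sigma>0 \<mu>1 \<sigma>1, OF q]
  obtain a b where ab: "\<forall>i<N. wt i = c \<longrightarrow> (\<forall>x.
      x - \<alpha> * expected_gradient N pe wt \<mu>0 \<sigma>0 \<mu>1 \<sigma>1 i x = b + a * x)"
    by auto
  have "gaussian_distributed M (Y i) (b + a * \<mu>) (\<bar>a\<bar> * \<sigma>)" if "i < N" "wt i = c" for i
    using X[OF that] by (rule gaussian_distributed_affine) (simp add: Y ab that)
  moreover have "0 \<le> \<bar>a\<bar> * \<sigma>"
    using \<open>0 \<le> \<sigma>\<close> by simp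
  ultimately show ?thesis
    by blast
qed

theorem propositionF5:
  fixes M :: "'a measure"
    and N k :: nat
    and pe \<alpha> :: real
    and wt :: "nat \<Rightarrow> real"
    and w :: "nat \<Rightarrow> nat \<Rightarrow> 'a \<Rightarrow> real"
    and \<mu>0 \<sigma>0 \<mu>1 \<sigma>1 :: real
  assumes "prob_space M"
    and "2 \<le> N"
    and "0 \<le> pe" and "pe \<le> 1"
    and "\<And>i. i < N \<Longrightarrow> wt i \<in> {0, 1}"
    and "0 \<le> \<sigma>0" and "0 \<le> \<sigma>1"
    and "\<And>i. i < N \<Longrightarrow> wt i = 0 \<Longrightarrow> gaussian_distributed M (w k i) \<mu>0 \<sigma>0"
    and "\<And>i. i < N \<Longrightarrow> wt i = 1 \<Longrightarrow> gaussian_distributed M (w k i) \<mu>1 \<sigma>1"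
    and "\<And>i \<omega>. i < N \<Longrightarrow> \<omega> \<in> space M \<Longrightarrow>
           w (Suc k) i \<omega> = w k i \<omega> - \<alpha> * expected_gradient N pe wt \<mu>0 \<sigma>0 \<mu>1 \<sigma>1 i (w k i \<omega>)"
  shows "\<exists>\<mu>0' \<sigma>0' \<mu>1' \<sigma>1'. 0 \<le> \<sigma>0' \<and> 0 \<le> \<sigma>1' \<and>
           (\<forall>i<N. wt i = 0 \<longrightarrow> gaussian_distributed M (w (Suc k) i) \<mu>0' \<sigma>0') \<and>
           (\<forall>i<N. wt i = 1 \<longrightarrow> gaussian_distributed M (w (Suc k) i) \<mu>1' \<sigma>1')"
proof -
  interpret prob_space M by fact
  obtain \<mu>0' \<sigma>0' where "0 \<le> \<sigma>0'"
    "\<forall>i<N. wt i = 0 \<longrightarrow> gaussian_distributed M (w (Suc k) i) \<mu>0' \<sigma>0'"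
    \<comment> \<open>Both classes are updated with the same moments of step \<open>k\<close>; only
      the class and its current law change between the two instances.\<close>
    using gradient_step_gaussian[of N wt 0, OF assms(8,10,6)] by auto
  moreover obtain \<mu>1' \<sigma>1' where "0 \<le> \<sigma>1'"
    "\<forall>i<N. wt i = 1 \<longrightarrow> gaussian_distributed M (w (Suc k) i) \<mu>1' \<sigma>1'"
    using gradient_step_gaussian[of N wt 1, OF assms(9,10,7)] by auto
  ultimately show ?thesis
    by blast
qed

end
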